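(* Let $p,q$ be real numbers with $\frac{4}{3} \leq p \leq \frac{1}{\frac{\log_2 3}{2} - \frac{1}{4}}$, $\frac{4}{3} \leq q \leq \frac{1}{\frac{\log_2 3}{2} - \frac{1}{4}}$ and $\frac{1}{p}+\frac{1}{q}=\frac{\log_2 6}{2}$. Then for every integer $d\geq 1$ and all $A,B \subseteq \{-1,1\}^d$, $$\widetilde{E}_2(A,B) \leq |A|^{2/p}\,|B|^{2/q}.$$ Furthermore, the range for $p$ and $q$ is sharp: if $1\leq p,q\leq\infty$ satisfy $\frac{1}{p}+\frac{1}{q}=\frac{\log_2 6}{2}$ and the inequality $\widetilde{E}_2(A,B) \leq |A|^{2/p}|B|^{2/q}$ holds for every $d\geq 1$ and all $A,B\subseteq\{-1,1\}^d$, then $\frac{4}{3} \leq p, q \leq \frac{1}{\frac{\log_2 3}{2} - \frac{1}{4}}$.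
   Context: For $A,B\subseteq\{-1,1\}^d$, the additive energy of $A$ and $B$ is $$\widetilde{E}_{2}(A,B):=\big|\{(a_1,a_2, b_1, b_2) \in A^{2} \times B^2 : a_1-b_1= a_2-b_2\}\big|,$$ where the differences are taken in $\mathbb{Z}^d$, and $|\cdot|$ denotes cardinality. The convention $1/\infty=0$ is used. *)

theory Defs
  imports Complex_Main "HOL-Library.FuncSet" "HOL-Library.Extended_Real"
begin

text \<open>
  Points of the cube are functions on the coordinate set \<open>{..<d}\<close>, extended by \<^const>\<open>undefined\<close>
  outside it, so that equality of points is equality of the \<open>d\<close> coordinates. The dimension \<open>d\<close>
  is a natural number rather than a type, because the sharpness claim has a hypothesis that
  quantifies over all dimensions.
\<close>

definition sign_cube :: "nat \<Rightarrow> (nat \<Rightarrow> int) set" where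
  "sign_cube d = {..<d} \<rightarrow>\<^sub>E {-1, 1}"

text \<open>The differences are compared coordinatewise, i.e. in \<open>\<int>\<^sup>d\<close>.\<close>

definition additive_energy :: "nat \<Rightarrow> (nat \<Rightarrow> int) set \<Rightarrow> (nat \<Rightarrow> int) set \<Rightarrow> nat" where
  "additive_energy d A B =
     card {(a1, a2, b1, b2). a1 \<in> A \<and> a2 \<in> A \<and> b1 \<in> B \<and> b2 \<in> B \<and>
                             (\<forall>i<d. a1 i - b1 i = a2 i - b2 i)}"

end

theory Submission
  imports Defs "HOL-Analysis.Convex" "HOL-Library.Indicator_Function"
begin

text \<open>
  Write \<open>\<alpha> = 2/p\<close> and \<open>\<beta> = 2/q\<close>, so that \<open>\<alpha> + \<beta> = log 2 6\<close>. The admissible range is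
  \<open>\<beta>\<^sub>0 \<le> \<alpha>, \<beta> \<le> 3/2\<close> with \<open>\<beta>\<^sub>0 = log 2 3 - 1/2 = log 2 6 - 3/2\<close>.

  \<^emph>\<open>Sufficiency.\<close> The additive energy is a quadrilinear form evaluated at indicator functions. On
  nonnegative functions the bound \<open>E(f, g) \<le> (\<Sum> f powr (2/\<alpha>)) powr \<alpha> * (\<Sum> g powr (2/\<beta>)) powr \<beta>\<close>
  follows by induction on the dimension (\<open>energy_form_le_powr\<close>). Splitting off one coordinate gives
  six terms, four energies of faces and two mixed terms, and Cauchy--Schwarz estimates the mixed
  terms by the energies. What remains is the two-point inequality
  \<open>(a\<^sub>0\<^sup>\<alpha> + a\<^sub>1\<^sup>\<alpha>) (b\<^sub>0\<^sup>\<beta> + b\<^sub>1\<^sup>\<beta>) + 2 (a\<^sub>0 a\<^sub>1)\<^sup>\<alpha>\<^sup>/\<^sup>2 (b\<^sub>0 b\<^sub>1)\<^sup>\<beta>\<^sup>/\<^sup>2 \<le> (a\<^sub>0 + a\<^sub>1)\<^sup>\<alpha> (b\<^sub>0 + b\<^sub>1)\<^sup>\<beta>\<close>.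
  It is needed only at the endpoint \<open>(\<alpha>, \<beta>) = (3/2, \<beta>\<^sub>0)\<close> (\<open>two_point\<close>). Indeed, the
  endpoint \<open>(\<beta>\<^sub>0, 3/2)\<close> follows by symmetry of the energy. If \<open>A\<close> is the larger of the two sets,
  then \<open>|A|\<^sup>\<alpha> |B|\<^sup>\<beta>\<close> with \<open>\<alpha> + \<beta>\<close> fixed is nondecreasing in \<open>\<alpha>\<close>, so that this second endpoint
  implies the whole range, and similarly if \<open>B\<close> is the larger one.

  \<^emph>\<open>Necessity.\<close> Suppose the bound holds for all \<open>A\<close> with \<open>B\<close> the full cube. The function
  \<open>x \<mapsto> v ^ #{i. x i = 1}\<close> takes only \<open>n + 1\<close> values on the \<open>n\<close>-dimensional cube, so decomposing it
  into its level sets extends the bound to it up to a factor \<open>(n + 1)\<^sup>2\<close>. Both sides being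
  multiplicative in \<open>n\<close>, the factor disappears upon taking \<open>n\<close>-th roots, which leaves
  \<open>2 v\<^sup>2 + 2 v + 2 \<le> (1 + v powr (2/\<alpha>)) powr \<alpha> * 2 powr \<beta>\<close> for all \<open>v > 0\<close>. Equality holds at
  \<open>v = 1\<close>, and the second-order condition there reads \<open>\<alpha> \<le> 3/2\<close>
  (\<open>exponent_le_of_additive_energy_le\<close>). By symmetry also \<open>\<beta> \<le> 3/2\<close>.
\<close>

section \<open>The two-point inequality\<close>

lemma powr_diff_convex_on:
  fixes \<gamma> :: real
  assumes "0 \<le> \<gamma>" "\<gamma> \<le> 1"
  shows "convex_on {0..<1} (\<lambda>t. (1 + t) powr \<gamma> - (1 - t) powr \<gamma>)"
proof (rule f''_ge0_imp_convex)
  show "convex {0..<1::real}"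
    by (simp add: convex_real_interval)
next
  fix t :: real assume t: "t \<in> {0..<1}"
  then show "((\<lambda>t. (1 + t) powr \<gamma> - (1 - t) powr \<gamma>) has_real_derivative
      \<gamma> * ((1 + t) powr (\<gamma> - 1) + (1 - t) powr (\<gamma> - 1))) (at t)"
    by (auto intro!: derivative_eq_intros simp: algebra_simps)
  show "((\<lambda>t. \<gamma> * ((1 + t) powr (\<gamma> - 1) + (1 - t) powr (\<gamma> - 1))) has_real_derivative
      \<gamma> * (1 - \<gamma>) * ((1 - t) powr (\<gamma> - 2) - (1 + t) powr (\<gamma> - 2))) (at t)"
    using t by (auto intro!: derivative_eq_intros simp: algebra_simps)
  have "(1 + t) powr (\<gamma> - 2) \<le> (1 - t) powr (\<gamma> - 2)"
    using t assms by (intro powr_mono2') auto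
  then show "0 \<le> \<gamma> * (1 - \<gamma>) * ((1 - t) powr (\<gamma> - 2) - (1 + t) powr (\<gamma> - 2))"
    using assms by simp
qed

text \<open>
  As a function of \<open>t\<^sup>2\<close> the left-hand side is convex, and the right-hand side is its chord between
  \<open>t = 0\<close> and \<open>t = 1\<close>.
\<close>

lemma powr_add_powr_le_chord:
  fixes \<beta> t :: real
  assumes \<beta>: "1 \<le> \<beta>" "\<beta> \<le> 2" and t: "\<bar>t\<bar> \<le> 1"
  shows "(1 + t) powr \<beta> + (1 - t) powr \<beta> \<le> 2 + (2 powr \<beta> - 2) * t\<^sup>2"
proof -
  define C where "C = 2 powr \<beta> - 2"
  define K where "K t = (1 + t) powr (\<beta> - 1) - (1 - t) powr (\<beta> - 1)" for t
  define h where "h t = 2 + C * t\<^sup>2 - (1 + t) powr \<beta> - (1 - t) powr \<beta>" for t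
  define h' where "h' t = 2 * C * t - \<beta> * K t" for t
  have K_convex: "convex_on {0..<1} K"
    unfolding K_def using \<beta> by (intro powr_diff_convex_on) auto
  have deriv: "(h has_derivative (\<lambda>x. x * h' t)) (at t)" if "0 < t" "t < 1" for t
  proof -
    have "(h has_real_derivative h' t) (at t)"
      unfolding h_def h'_def K_def using that
      by (auto intro!: derivative_eq_intros simp: algebra_simps)
    then show ?thesis
      by (simp add: has_field_derivative_def mult_commute_abs)
  qed
  have cont: "continuous_on {a..b} h" if "0 \<le> a" "b \<le> 1" for a b
    unfolding h_def using that \<beta> by (intro continuous_intros continuous_on_powr') auto
  have h_ends: "h 0 = 0" "h 1 = 0"
    by (simp_all add: h_def C_def)
  have nonneg: "0 \<le> h u" if u: "0 \<le> u" "u \<le> 1" for u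
  proof (rule ccontr)
    assume "\<not> 0 \<le> h u"
    then have neg: "h u < 0" and u': "0 < u" "u < 1"
      using h_ends u by (cases "u = 0 \<or> u = 1"; force)+
    obtain r where r: "0 < r" "r < u" "h u - h 0 = (u - 0) * h' r"
      by (rule mvt[OF \<open>0 < u\<close> cont, of "\<lambda>t x. x * h' t"]) (use u' deriv in auto)
    obtain s where s: "u < s" "s < 1" "h 1 - h u = (1 - u) * h' s"
      by (rule mvt[OF \<open>u < 1\<close> cont, of "\<lambda>t x. x * h' t"]) (use u' deriv in auto)
    have "h' r < 0"
      using r neg h_ends u' by (simp add: mult_less_0_iff)
    moreover have "0 < h' s"
      using s neg h_ends u' by (metis diff_0 diff_gt_0_iff_gt neg_0_less_iff_less zero_less_mult_pos)
    \<comment> \<open>\<open>h'\<close> is concave with \<open>h' 0 = 0\<close>, so it cannot pass from negative to positive values.\<close>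
    moreover have "(r / s) * h' s \<le> h' r"
    proof -
      have "K ((1 - r / s) *\<^sub>R 0 + (r / s) *\<^sub>R s) \<le> (1 - r / s) * K 0 + (r / s) * K s"
        by (rule convex_onD[OF K_convex]) (use r s in auto)
      then have "K r \<le> (r / s) * K s"
        using r s by (simp add: K_def)
      then have "\<beta> * K r \<le> \<beta> * ((r / s) * K s)"
        using \<beta> by (intro mult_left_mono) auto
      then show ?thesis
        using r s by (simp add: h'_def algebra_simps)
    qed
    moreover have "0 < r / s"
      using r s by simp
    ultimately show False
      by (smt (verit) mult_pos_pos)
  qed
  have "0 \<le> h \<bar>t\<bar>"
    using nonneg t by simp
  then show ?thesis
    by (cases "0 \<le> t") (simp_all add: h_def C_def)
qed

lemma sqrt2_bounds: "1.414 < sqrt 2" "sqrt 2 < 1.4145"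
proof -
  show "1.414 < sqrt (2::real)"
    by (rule real_less_rsqrt) (simp add: power2_eq_square)
  show "sqrt (2::real) < 1.4145"
    by (rule real_less_lsqrt) (simp_all add: power2_eq_square)
qed

text \<open>
  The two-point inequality in normalized form. For \<open>a\<^sub>0 + a\<^sub>1 = b\<^sub>0 + b\<^sub>1 = 1\<close> one takes
  \<open>z\<^sup>2 = 2 * sqrt (a\<^sub>0 * a\<^sub>1)\<close>, \<open>n = 2 * sqrt (b\<^sub>0 * b\<^sub>1)\<close> and \<open>S = a\<^sub>0 powr (3/2) + a\<^sub>1 powr (3/2)\<close>.
  Equality holds at \<open>z = n = 1\<close>, i.e. for constant functions.
\<close>

lemma two_point_normalized:
  fixes S z n :: real
  assumes z: "0 \<le> z" "z \<le> 1" and n: "0 \<le> n" "n \<le> 1"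
    and S: "0 \<le> S" "S\<^sup>2 = 1 - (3 * z ^ 4 - z ^ 6) / 4"
  shows "(1 - (1 - 2 * sqrt 2 / 3) * n\<^sup>2) * S + z ^ 3 * n / 3 \<le> 1"
proof -
  define c where "c = 1 - 2 * sqrt 2 / (3::real)"
  have c: "0.057 \<le> c" "c \<le> 0.0574"
    using sqrt2_bounds by (simp_all add: c_def)
  have z64: "z ^ 6 \<le> z ^ 4"
    using z by (intro power_decreasing) auto
  have "z ^ 6 \<le> 3 * z ^ 4"
    using z64 zero_le_power[OF z(1), of 4] by linarith
  then have "S\<^sup>2 \<le> 1\<^sup>2"
    by (simp add: S)
  then have S1: "S \<le> 1"
    by (rule power2_le_imp_le) simp
  show ?thesis
  proof (cases "z\<^sup>2 \<le> 1/2")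
    case True
    define m where "m = z\<^sup>2"
    have m: "0 \<le> m" "m \<le> 1/2"
      using True by (auto simp: m_def)
    have zm: "z ^ 4 = m\<^sup>2" "z ^ 6 = m ^ 3" "(z ^ 3)\<^sup>2 = m ^ 3"
      by (simp_all add: m_def flip: power_mult)
    have "m ^ 3 \<ge> 0" "m\<^sup>2 \<le> 1/4"
      using m power_mono[of m "1/2" 2] by (simp_all add: power2_eq_square)
    moreover have "81/100 \<le> 1 - (3 * u - v) / 4" if "0 \<le> v" "u \<le> 1/4" for u v :: real
      using that by simp
    ultimately have "81/100 \<le> S\<^sup>2"
      unfolding S zm by blast
    then have "0.9\<^sup>2 \<le> S\<^sup>2"
      by (simp add: power2_eq_square[of "9/10"])
    then have S9: "0.9 \<le> S"
      by (rule power2_le_imp_le) (use S in simp)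
    have one_minus: "4 * ((1 - S) * (1 + S)) = m\<^sup>2 * (3 - m)"
    proof -
      have "4 * ((1 - S) * (1 + S)) = 4 * (1 - S\<^sup>2)"
        by (simp add: algebra_simps power2_eq_square)
      also have "\<dots> = 3 * m\<^sup>2 - m ^ 3"
        unfolding S(2) zm by simp
      finally show ?thesis
        by (simp add: algebra_simps power2_eq_square power3_eq_cube)
    qed
    \<comment> \<open>The difference of the two sides is a quadratic polynomial in \<open>n\<close>. Its discriminant is
      nonpositive.\<close>
    have "(z ^ 3)\<^sup>2 * (1 + S) \<le> (36 * c * S * (1 - S)) * (1 + S)"
    proof -
      have "m * (1 + S) \<le> 1"
        using mult_mono[of m "1/2" "1 + S" 2] m S1 S by simp
      also have "1 \<le> 9 * (0.057 * 0.9) * (2.5::real)"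
        by simp
      also have "\<dots> \<le> 9 * (c * S) * (3 - m)"
        using c S9 m by (intro mult_mono) auto
      finally have "m\<^sup>2 * (m * (1 + S)) \<le> m\<^sup>2 * (9 * (c * S) * (3 - m))"
        by (rule mult_left_mono) simp
      also have "\<dots> = 9 * (c * S) * (4 * ((1 - S) * (1 + S)))"
        unfolding one_minus by simp
      finally show ?thesis
        unfolding zm by (simp add: algebra_simps power2_eq_square power3_eq_cube)
    qed
    then have disc: "(z ^ 3)\<^sup>2 \<le> 36 * c * S * (1 - S)"
      using S9 by simp
    have cS: "0 < c * S"
      using c S9 by simp
    have "0 \<le> (6 * (c * S) * n - z ^ 3)\<^sup>2 + (36 * c * S * (1 - S) - (z ^ 3)\<^sup>2)"
      using disc by simp
    also have "\<dots> = 36 * (c * S) * (1 - ((1 - c * n\<^sup>2) * S + z ^ 3 * n / 3))"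
      by (simp add: power2_eq_square algebra_simps)
    finally have "36 * (c * S) * 0 \<le> 36 * (c * S) * (1 - ((1 - c * n\<^sup>2) * S + z ^ 3 * n / 3))"
      by (simp only: mult_zero_right)
    then have "0 \<le> 1 - ((1 - c * n\<^sup>2) * S + z ^ 3 * n / 3)"
      by (rule mult_left_le_imp_le) (use cS in linarith)
    then show ?thesis
      by (simp add: c_def)
  next
    case False
    have "0.7\<^sup>2 \<le> z\<^sup>2"
      using False by (simp add: power2_eq_square)
    then have "0.7 \<le> z"
      by (rule power2_le_imp_le) (use z in simp)
    then have "0.5 * 0.7 \<le> z\<^sup>2 * z"
      using False by (intro mult_mono) auto
    then have z3: "0.35 \<le> z ^ 3"
      by (simp add: power3_eq_cube power2_eq_square)
    \<comment> \<open>The left-hand side is largest at \<open>n = 1\<close>, where squaring reduces the claim to a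
      polynomial inequality in \<open>z\<close> with a double root at \<open>1\<close>.\<close>
    have "c * (S * (1 + n)) \<le> 0.0574 * (1 * 2)"
      using c S1 S n by (intro mult_mono) auto
    then have "0 \<le> (1 - n) * (z ^ 3 / 3 - c * (S * (1 + n)))"
      using z3 n by (intro mult_nonneg_nonneg) auto
    then have mono: "(1 - c * n\<^sup>2) * S + z ^ 3 * n / 3 \<le> (1 - c) * S + z ^ 3 / 3"
      by (simp add: algebra_simps power2_eq_square diff_divide_distrib)
    have z3_le: "z ^ 3 \<le> 1"
      using z by (simp add: power_le_one)
    have "z ^ 3 \<le> z\<^sup>2" "z ^ 4 \<le> z\<^sup>2"
      using z by (intro power_decreasing; simp)+
    then have "0 \<le> (1 - z)\<^sup>2 * (1 + 2 * z + 3 * z\<^sup>2 - 2 * z ^ 3 - z ^ 4)"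
      using z by (intro mult_nonneg_nonneg) auto
    also have "\<dots> = (3 - z ^ 3)\<^sup>2 - 8 * (1 - (3 * z ^ 4 - z ^ 6) / 4)"
      by algebra
    also have "\<dots> = (3 - z ^ 3)\<^sup>2 - (2 * sqrt 2 * S)\<^sup>2"
      by (simp add: power_mult_distrib S)
    finally have "(2 * sqrt 2 * S)\<^sup>2 \<le> (3 - z ^ 3)\<^sup>2"
      by simp
    then have "2 * sqrt 2 * S \<le> 3 - z ^ 3"
      by (rule power2_le_imp_le) (use z3_le in simp)
    then have "(1 - c) * S + z ^ 3 / 3 \<le> 1"
      by (simp add: c_def)
    with mono show ?thesis
      by (simp add: c_def)
  qed
qed

text \<open>
  The exponent that accompanies \<open>3/2\<close> at the endpoint of the admissible range, and at the same time
  the smallest admissible exponent.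
\<close>

definition \<beta>\<^sub>0 :: real where "\<beta>\<^sub>0 = log 2 3 - 1/2"

lemma two_powr_\<beta>\<^sub>0: "2 powr \<beta>\<^sub>0 = 3 / sqrt 2"
  by (simp add: \<beta>\<^sub>0_def powr_diff powr_half_sqrt)

lemma log_2_6: "log 2 6 = \<beta>\<^sub>0 + 3/2"
proof -
  have "log 2 (2 * 3 :: real) = 1 + log 2 3"
    by (subst log_mult) auto
  then show ?thesis
    by (simp add: \<beta>\<^sub>0_def)
qed

lemma \<beta>\<^sub>0_bounds: "1 \<le> \<beta>\<^sub>0" "\<beta>\<^sub>0 \<le> 3/2"
proof -
  have "2 powr 1 \<le> 2 powr \<beta>\<^sub>0"
    unfolding two_powr_\<beta>\<^sub>0 using sqrt2_bounds by (simp add: field_simps)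
  then show "1 \<le> \<beta>\<^sub>0"
    by (subst (asm) powr_le_cancel_iff) auto
  have "log 2 3 \<le> log 2 (4::real)"
    by simp
  also have "log 2 (4::real) = 2"
    using log_pow_cancel[of "2::real" 2] by simp
  finally show "\<beta>\<^sub>0 \<le> 3/2"
    by (simp add: \<beta>\<^sub>0_def)
qed

lemma two_point_unit_mass:
  fixes a\<^sub>0 a\<^sub>1 b\<^sub>0 b\<^sub>1 :: real
  assumes nn: "0 \<le> a\<^sub>0" "0 \<le> a\<^sub>1" "0 \<le> b\<^sub>0" "0 \<le> b\<^sub>1" and unit: "a\<^sub>0 + a\<^sub>1 = 1" "b\<^sub>0 + b\<^sub>1 = 1"
  shows "(a\<^sub>0 powr (3/2) + a\<^sub>1 powr (3/2)) * (b\<^sub>0 powr \<beta>\<^sub>0 + b\<^sub>1 powr \<beta>\<^sub>0)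
      + 2 * ((a\<^sub>0 * a\<^sub>1) powr (3/4) * (b\<^sub>0 * b\<^sub>1) powr (\<beta>\<^sub>0/2)) \<le> 1"
proof -
  define x y n where "x = sqrt a\<^sub>0" and "y = sqrt a\<^sub>1" and "n = 2 * sqrt (b\<^sub>0 * b\<^sub>1)"
  define z where "z = sqrt (2 * (x * y))"
  define S where "S = (x + y) * (1 - x * y)"
  have xy: "0 \<le> x" "0 \<le> y" "x\<^sup>2 = a\<^sub>0" "y\<^sup>2 = a\<^sub>1" "x\<^sup>2 + y\<^sup>2 = 1"
    using nn unit by (auto simp: x_def y_def)
  have "0 \<le> (x - y)\<^sup>2"
    by simp
  then have xy1: "2 * (x * y) \<le> 1"
    using xy by (simp add: power2_eq_square algebra_simps)
  have z2: "z\<^sup>2 = 2 * (x * y)"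
    using xy by (simp add: z_def)
  have z: "0 \<le> z" "z \<le> 1"
    using xy xy1 by (auto simp: z_def)
  have n2: "n\<^sup>2 = 1 - (b\<^sub>0 - b\<^sub>1)\<^sup>2"
  proof -
    have "n\<^sup>2 = 4 * (b\<^sub>0 * b\<^sub>1)"
      using nn by (simp add: n_def power_mult_distrib)
    also have "\<dots> = (b\<^sub>0 + b\<^sub>1)\<^sup>2 - (b\<^sub>0 - b\<^sub>1)\<^sup>2"
      by algebra
    finally show ?thesis
      using unit by simp
  qed
  have n: "0 \<le> n" "n \<le> 1"
  proof -
    show "0 \<le> n"
      using nn by (simp add: n_def)
    have "n\<^sup>2 \<le> 1\<^sup>2"
      unfolding n2 by simp
    then show "n \<le> 1"
      by (rule power2_le_imp_le) simp
  qed
  have S: "0 \<le> S" "S\<^sup>2 = 1 - (3 * z ^ 4 - z ^ 6) / 4"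
  proof -
    show "0 \<le> S"
      unfolding S_def using xy xy1 by (intro mult_nonneg_nonneg) auto
    have z46: "z ^ 4 = (2 * (x * y))\<^sup>2" "z ^ 6 = (2 * (x * y)) ^ 3"
      by (simp_all add: flip: z2 power_mult)
    have "(x + y)\<^sup>2 = 1 + 2 * (x * y)"
      using xy(5) by (simp add: power2_eq_square algebra_simps)
    then have S2: "S\<^sup>2 = (1 + 2 * (x * y)) * (1 - x * y)\<^sup>2"
      by (simp add: S_def power_mult_distrib)
    have "(1 + 2 * u) * (1 - u)\<^sup>2 = 1 - (3 * (2 * u)\<^sup>2 - (2 * u) ^ 3) / 4" for u :: real
      by (simp add: power2_eq_square power3_eq_cube field_simps)
    from this[of "x * y"] show "S\<^sup>2 = 1 - (3 * z ^ 4 - z ^ 6) / 4"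
      unfolding S2 z46 .
  qed
  have cube: "(w\<^sup>2) powr (3/2) = w ^ 3" if "0 \<le> w" for w :: real
  proof -
    have "(w\<^sup>2) powr (3/2) = (w powr 2) powr (3/2)"
      using that by simp
    also have "\<dots> = w ^ 3"
      unfolding powr_powr using that by simp
    finally show ?thesis .
  qed
  have A: "a\<^sub>0 powr (3/2) + a\<^sub>1 powr (3/2) = S"
  proof -
    have "a\<^sub>0 powr (3/2) + a\<^sub>1 powr (3/2) = x ^ 3 + y ^ 3"
      using cube[of x] cube[of y] xy by simp
    also have "\<dots> = (x + y) * (x\<^sup>2 + y\<^sup>2 - x * y)"
      by algebra
    finally show ?thesis
      using xy by (simp add: S_def)
  qed
  have B: "b\<^sub>0 powr \<beta>\<^sub>0 + b\<^sub>1 powr \<beta>\<^sub>0 \<le> 1 - (1 - 2 * sqrt 2 / 3) * n\<^sup>2"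
  proof -
    define t where "t = b\<^sub>0 - b\<^sub>1"
    have b: "2 * b\<^sub>0 = 1 + t" "2 * b\<^sub>1 = 1 - t" and t: "\<bar>t\<bar> \<le> 1"
      using unit nn by (auto simp: t_def)
    have "2 powr \<beta>\<^sub>0 * (b\<^sub>0 powr \<beta>\<^sub>0 + b\<^sub>1 powr \<beta>\<^sub>0) = (1 + t) powr \<beta>\<^sub>0 + (1 - t) powr \<beta>\<^sub>0"
      using nn by (simp add: distrib_left flip: powr_mult b)
    also have "\<dots> \<le> 2 + (2 powr \<beta>\<^sub>0 - 2) * t\<^sup>2"
      using \<beta>\<^sub>0_bounds t by (intro powr_add_powr_le_chord) auto
    finally have "b\<^sub>0 powr \<beta>\<^sub>0 + b\<^sub>1 powr \<beta>\<^sub>0 \<le> (2 + (3 / sqrt 2 - 2) * t\<^sup>2) * (sqrt 2 / 3)"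
      unfolding two_powr_\<beta>\<^sub>0 by (simp add: field_simps)
    also have "\<dots> = 1 - (1 - 2 * sqrt 2 / 3) * n\<^sup>2"
      unfolding n2 t_def[symmetric] by (simp add: field_simps)
    finally show ?thesis .
  qed
  have cross: "2 * ((a\<^sub>0 * a\<^sub>1) powr (3/4) * (b\<^sub>0 * b\<^sub>1) powr (\<beta>\<^sub>0/2)) \<le> z ^ 3 * n / 3"
  proof -
    have "(x * y) powr (3/2) = ((z / sqrt 2)\<^sup>2) powr (3/2)"
      using z2 by (simp add: power_divide)
    also have "\<dots> = (z / sqrt 2) ^ 3"
      using z by (intro cube) simp
    also have "\<dots> = z ^ 3 / (2 * sqrt 2)"
      by (simp add: power_divide power3_eq_cube)
    finally have "(x * y) powr (3/2) = z ^ 3 / (2 * sqrt 2)" .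
    moreover have "a\<^sub>0 * a\<^sub>1 = (x * y) powr 2"
      using xy by (simp add: power_mult_distrib)
    then have "(a\<^sub>0 * a\<^sub>1) powr (3/4) = (x * y) powr (3/2)"
      by (simp add: powr_powr)
    ultimately have A': "(a\<^sub>0 * a\<^sub>1) powr (3/4) = z ^ 3 / (2 * sqrt 2)"
      by simp
    have "(b\<^sub>0 * b\<^sub>1) powr (\<beta>\<^sub>0/2) = (n / 2) powr \<beta>\<^sub>0"
      using nn by (simp add: n_def powr_powr flip: powr_half_sqrt)
    also have "\<dots> = n powr \<beta>\<^sub>0 * (sqrt 2 / 3)"
      using n by (simp add: powr_divide two_powr_\<beta>\<^sub>0)
    also have "\<dots> \<le> n * (sqrt 2 / 3)"
      using powr_mono'[of 1 \<beta>\<^sub>0 n] \<beta>\<^sub>0_bounds n by (intro mult_right_mono) auto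
    finally have "(a\<^sub>0 * a\<^sub>1) powr (3/4) * (b\<^sub>0 * b\<^sub>1) powr (\<beta>\<^sub>0/2)
        \<le> z ^ 3 / (2 * sqrt 2) * (n * (sqrt 2 / 3))"
      unfolding A' using z by (intro mult_left_mono) auto
    then show ?thesis
      by simp
  qed
  have "S * (b\<^sub>0 powr \<beta>\<^sub>0 + b\<^sub>1 powr \<beta>\<^sub>0) + z ^ 3 * n / 3
      \<le> (1 - (1 - 2 * sqrt 2 / 3) * n\<^sup>2) * S + z ^ 3 * n / 3"
    using mult_left_mono[OF B S(1)] by (simp add: mult.commute)
  also have "\<dots> \<le> 1"
    by (rule two_point_normalized[OF z n S])
  finally show ?thesis
    unfolding A using cross by simp
qed

lemma two_point:
  fixes a\<^sub>0 a\<^sub>1 b\<^sub>0 b\<^sub>1 :: real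
  assumes nn: "0 \<le> a\<^sub>0" "0 \<le> a\<^sub>1" "0 \<le> b\<^sub>0" "0 \<le> b\<^sub>1"
  shows "(a\<^sub>0 powr (3/2) + a\<^sub>1 powr (3/2)) * (b\<^sub>0 powr \<beta>\<^sub>0 + b\<^sub>1 powr \<beta>\<^sub>0)
      + 2 * ((a\<^sub>0 * a\<^sub>1) powr (3/4) * (b\<^sub>0 * b\<^sub>1) powr (\<beta>\<^sub>0/2))
    \<le> (a\<^sub>0 + a\<^sub>1) powr (3/2) * (b\<^sub>0 + b\<^sub>1) powr \<beta>\<^sub>0"
proof (cases "a\<^sub>0 + a\<^sub>1 = 0 \<or> b\<^sub>0 + b\<^sub>1 = 0")
  case True
  then have "a\<^sub>0 = 0 \<and> a\<^sub>1 = 0 \<or> b\<^sub>0 = 0 \<and> b\<^sub>1 = 0"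
    using nn by linarith
  then show ?thesis
    by auto
next
  case False
  define s t where "s = a\<^sub>0 + a\<^sub>1" and "t = b\<^sub>0 + b\<^sub>1"
  have pos: "0 < s" "0 < t"
    using False nn by (auto simp: s_def t_def)
  define x\<^sub>0 x\<^sub>1 y\<^sub>0 y\<^sub>1 where "x\<^sub>0 = a\<^sub>0 / s" and "x\<^sub>1 = a\<^sub>1 / s" and "y\<^sub>0 = b\<^sub>0 / t" and "y\<^sub>1 = b\<^sub>1 / t"
  have nn': "0 \<le> x\<^sub>0" "0 \<le> x\<^sub>1" "0 \<le> y\<^sub>0" "0 \<le> y\<^sub>1"
    using nn pos by (simp_all add: x\<^sub>0_def x\<^sub>1_def y\<^sub>0_def y\<^sub>1_def)
  have eqs: "a\<^sub>0 = s * x\<^sub>0" "a\<^sub>1 = s * x\<^sub>1" "b\<^sub>0 = t * y\<^sub>0" "b\<^sub>1 = t * y\<^sub>1"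
    using pos by (simp_all add: x\<^sub>0_def x\<^sub>1_def y\<^sub>0_def y\<^sub>1_def)
  have unit: "x\<^sub>0 + x\<^sub>1 = 1" "y\<^sub>0 + y\<^sub>1 = 1"
    using pos by (simp_all add: x\<^sub>0_def x\<^sub>1_def y\<^sub>0_def y\<^sub>1_def s_def t_def flip: add_divide_distrib)
  have sq: "(s * x\<^sub>0 * (s * x\<^sub>1)) powr (3/4) = s powr (3/2) * (x\<^sub>0 * x\<^sub>1) powr (3/4)"
    "(t * y\<^sub>0 * (t * y\<^sub>1)) powr (\<beta>\<^sub>0/2) = t powr \<beta>\<^sub>0 * (y\<^sub>0 * y\<^sub>1) powr (\<beta>\<^sub>0/2)"
    using nn' pos powr_add[of s "3/4" "3/4"] powr_add[of t "\<beta>\<^sub>0/2" "\<beta>\<^sub>0/2"]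
    by (simp_all add: powr_mult)
  have main: "s powr (3/2) * t powr \<beta>\<^sub>0 *
      ((x\<^sub>0 powr (3/2) + x\<^sub>1 powr (3/2)) * (y\<^sub>0 powr \<beta>\<^sub>0 + y\<^sub>1 powr \<beta>\<^sub>0)
        + 2 * ((x\<^sub>0 * x\<^sub>1) powr (3/4) * (y\<^sub>0 * y\<^sub>1) powr (\<beta>\<^sub>0/2))) \<le> s powr (3/2) * t powr \<beta>\<^sub>0 * 1"
    by (intro mult_left_mono two_point_unit_mass nn' unit) auto
  have split: "(s * x\<^sub>0) powr r = s powr r * x\<^sub>0 powr r" "(s * x\<^sub>1) powr r = s powr r * x\<^sub>1 powr r"
    "(t * y\<^sub>0) powr r = t powr r * y\<^sub>0 powr r" "(t * y\<^sub>1) powr r = t powr r * y\<^sub>1 powr r" for r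
    using pos nn' by (simp_all add: powr_mult)
  show ?thesis
    unfolding s_def[symmetric] t_def[symmetric] unfolding eqs sq split
    using main by (simp add: algebra_simps)
qed

section \<open>The energy as a quadrilinear form\<close>

lemma finite_sign_cube [simp]: "finite (sign_cube d)"
  by (simp add: sign_cube_def finite_PiE)

lemma sign_cube_0: "sign_cube 0 = {\<lambda>_. undefined}"
  by (simp add: sign_cube_def)

lemma sum_sign_cube_Suc:
  fixes \<phi> :: "(nat \<Rightarrow> int) \<Rightarrow> real"
  shows "(\<Sum>x\<in>sign_cube (Suc d). \<phi> x) = (\<Sum>x\<in>sign_cube d. \<phi> (x(d := 1)) + \<phi> (x(d := -1)))"
proof -
  have eq: "sign_cube (Suc d) = (\<lambda>(s, x). x(d := s)) ` ({-1, 1} \<times> sign_cube d)"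
    by (simp add: sign_cube_def lessThan_Suc PiE_insert_eq)
  have inj: "inj_on (\<lambda>(s, x). x(d := s)) ({-1, 1} \<times> sign_cube d)"
    unfolding sign_cube_def by (rule inj_combinator) simp
  have "(\<Sum>x\<in>sign_cube (Suc d). \<phi> x) = (\<Sum>s\<in>{-1, 1}. \<Sum>x\<in>sign_cube d. \<phi> (x(d := s)))"
    unfolding eq sum.reindex[OF inj] sum.cartesian_product
    by (rule sum.cong) auto
  then show ?thesis
    by (simp add: sum.distrib add.commute)
qed

text \<open>
  The quadrilinear form whose value at the indicator functions of \<open>A\<close>, \<open>B\<close>, \<open>A\<close>, \<open>B\<close> is the
  additive energy. The arguments come in the order \<open>a - b = a' - b'\<close>, so that the first two and the
  last two belong together.
\<close>

definition energy_form ::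
  "nat \<Rightarrow> ((nat \<Rightarrow> int) \<Rightarrow> real) \<Rightarrow> ((nat \<Rightarrow> int) \<Rightarrow> real) \<Rightarrow>
    ((nat \<Rightarrow> int) \<Rightarrow> real) \<Rightarrow> ((nat \<Rightarrow> int) \<Rightarrow> real) \<Rightarrow> real" where
  "energy_form d f g h k =
    (\<Sum>a\<in>sign_cube d. \<Sum>b\<in>sign_cube d. \<Sum>a'\<in>sign_cube d. \<Sum>b'\<in>sign_cube d.
      f a * g b * h a' * k b' * of_bool (\<forall>i<d. a i - b i = a' i - b' i))"

lemma energy_form_nonneg:
  assumes "\<And>x. 0 \<le> f x" "\<And>x. 0 \<le> g x" "\<And>x. 0 \<le> h x" "\<And>x. 0 \<le> k x"
  shows "0 \<le> energy_form d f g h k"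
  unfolding energy_form_def using assms by (intro sum_nonneg mult_nonneg_nonneg) auto

lemma energy_form_0: "energy_form 0 f g h k =
    f (\<lambda>_. undefined) * g (\<lambda>_. undefined) * h (\<lambda>_. undefined) * k (\<lambda>_. undefined)"
  by (simp add: energy_form_def sign_cube_0)

text \<open>
  Of the 16 choices of signs in the last coordinate, six satisfy \<open>s - r = s' - r'\<close>: the four with
  \<open>s = s'\<close> and \<open>r = r'\<close>, and the two with \<open>s = r \<noteq> s' = r'\<close>.
\<close>

lemma energy_form_Suc:
  defines "face \<equiv> \<lambda>d s f x. f (x(d := s))"
  shows "energy_form (Suc d) f g h k =
      energy_form d (face d 1 f) (face d 1 g) (face d 1 h) (face d 1 k)
    + energy_form d (face d 1 f) (face d (-1) g) (face d 1 h) (face d (-1) k)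
    + energy_form d (face d (-1) f) (face d 1 g) (face d (-1) h) (face d 1 k)
    + energy_form d (face d (-1) f) (face d (-1) g) (face d (-1) h) (face d (-1) k)
    + (energy_form d (face d 1 f) (face d 1 g) (face d (-1) h) (face d (-1) k)
    + energy_form d (face d (-1) f) (face d (-1) g) (face d 1 h) (face d 1 k))"
proof -
  have cond: "(\<forall>i<Suc d. (a(d := s)) i - (b(d := r)) i = (a'(d := s')) i - (b'(d := r')) i) \<longleftrightarrow>
      (\<forall>i<d. a i - b i = a' i - b' i) \<and> s - r = s' - r'"
    for a b a' b' :: "nat \<Rightarrow> int" and s r s' r'
    by (auto simp: less_Suc_eq)
  show ?thesis
    unfolding energy_form_def sum_sign_cube_Suc cond
    by (simp add: sum.distrib[symmetric] face_def algebra_simps)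
qed

text \<open>
  Grouping the pairs \<open>(a, b)\<close> by their difference \<open>\<delta> (a, b)\<close> writes the form as an inner product over
  the set of differences.
\<close>

lemma energy_form_Cauchy_Schwarz:
  "(energy_form d f g h k)\<^sup>2 \<le> energy_form d f g f g * energy_form d h k h k"
proof -
  define P where "P = sign_cube d \<times> sign_cube d"
  define \<delta> :: "(nat \<Rightarrow> int) \<times> (nat \<Rightarrow> int) \<Rightarrow> nat \<Rightarrow> int"
    where "\<delta> = (\<lambda>(a, b) i. if i < d then a i - b i else 0)"
  define R where "R f g v = (\<Sum>(a, b)\<in>P. f a * g b * of_bool (\<delta> (a, b) = v))" for f g :: "(nat \<Rightarrow> int) \<Rightarrow> real" and v
  have fin: "finite P"
    by (simp add: P_def)
  have form: "energy_form d f g h k = (\<Sum>v\<in>\<delta> ` P. R f g v * R h k v)" for f g h k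
  proof -
    have "energy_form d f g h k
        = (\<Sum>(a, b)\<in>P. \<Sum>(a', b')\<in>P. f a * g b * (h a' * k b' * of_bool (\<delta> (a', b') = \<delta> (a, b))))"
      unfolding energy_form_def P_def sum.cartesian_product[symmetric]
      by (intro sum.cong refl) (auto simp: \<delta>_def fun_eq_iff)
    also have "\<dots> = (\<Sum>(a, b)\<in>P. f a * g b * R h k (\<delta> (a, b)))"
      by (simp add: R_def sum_distrib_left case_prod_unfold)
    also have "\<dots> = (\<Sum>(a, b)\<in>P. \<Sum>v\<in>\<delta> ` P. f a * g b * of_bool (\<delta> (a, b) = v) * R h k v)"
      using fin by (intro sum.cong refl) (auto simp: sum.delta of_bool_def if_distrib if_distribR cong: if_cong)
    also have "\<dots> = (\<Sum>v\<in>\<delta> ` P. R f g v * R h k v)"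
      unfolding R_def case_prod_unfold sum_distrib_right by (rule sum.swap)
    finally show ?thesis .
  qed
  show ?thesis
    unfolding form using Cauchy_Schwarz_ineq_sum[of "R f g" "R h k" "\<delta> ` P"]
    by (simp add: power2_eq_square)
qed

lemma additive_energy_eq_form:
  assumes "A \<subseteq> sign_cube d" "B \<subseteq> sign_cube d"
  shows "real (additive_energy d A B) =
    energy_form d (indicator A) (indicator B) (indicator A) (indicator B)"
proof -
  define C where "C = sign_cube d"
  define Q where "Q = (\<lambda>(a, b, a', b'). a \<in> A \<and> b \<in> B \<and> a' \<in> A \<and> b' \<in> B \<and>
      (\<forall>i<d. a i - b i = a' i - b' i))"
  have "additive_energy d A B = card {x \<in> C \<times> C \<times> C \<times> C. Q x}"
    unfolding additive_energy_def
    by (rule bij_betw_same_card[of "\<lambda>(a, a', b, b'). (a, b, a', b')"],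
        rule bij_betwI[of _ _ _ "\<lambda>(a, b, a', b'). (a, a', b, b')"])
      (use assms in \<open>auto simp: Q_def C_def\<close>)
  then have "real (additive_energy d A B) = (\<Sum>x \<in> C \<times> C \<times> C \<times> C. of_bool (Q x))"
    by (simp add: C_def of_bool_def sum.If_cases Int_def)
  also have "\<dots> = energy_form d (indicator A) (indicator B) (indicator A) (indicator B)"
    unfolding energy_form_def C_def sum.cartesian_product
    by (intro sum.cong refl) (auto simp: Q_def indicator_def)
  finally show ?thesis .
qed

lemma additive_energy_commute: "additive_energy d A B = additive_energy d B A"
  unfolding additive_energy_def
  by (rule bij_betw_same_card[of "\<lambda>(a, a', b, b'). (b, b', a, a')"],
      rule bij_betwI[of _ _ _ "\<lambda>(b, b', a, a'). (a, a', b, b')"]) (auto; smt (verit))+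

text \<open>
  The two-point inequality tensorizes. It is used in the induction step with the values
  \<open>\<Sum> f powr (2/\<alpha>)\<close> and \<open>\<Sum> g powr (2/\<beta>)\<close> on the two faces of the cube.
\<close>

lemma energy_form_le_powr:
  fixes \<alpha> \<beta> :: real
  assumes \<alpha>: "0 < \<alpha>" and \<beta>: "0 < \<beta>"
    and two_point: "\<And>a\<^sub>0 a\<^sub>1 b\<^sub>0 b\<^sub>1 :: real. 0 \<le> a\<^sub>0 \<Longrightarrow> 0 \<le> a\<^sub>1 \<Longrightarrow> 0 \<le> b\<^sub>0 \<Longrightarrow> 0 \<le> b\<^sub>1 \<Longrightarrow>
      (a\<^sub>0 powr \<alpha> + a\<^sub>1 powr \<alpha>) * (b\<^sub>0 powr \<beta> + b\<^sub>1 powr \<beta>)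
        + 2 * ((a\<^sub>0 * a\<^sub>1) powr (\<alpha>/2) * (b\<^sub>0 * b\<^sub>1) powr (\<beta>/2))
      \<le> (a\<^sub>0 + a\<^sub>1) powr \<alpha> * (b\<^sub>0 + b\<^sub>1) powr \<beta>"
    and f: "\<And>x. 0 \<le> f x" and g: "\<And>x. 0 \<le> g x"
  shows "energy_form d f g f g \<le>
    (\<Sum>x\<in>sign_cube d. f x powr (2/\<alpha>)) powr \<alpha> * (\<Sum>x\<in>sign_cube d. g x powr (2/\<beta>)) powr \<beta>"
  using f g
proof (induction d arbitrary: f g)
  case 0
  have "(w powr (2/r)) powr r = w\<^sup>2" if "0 \<le> w" "0 < r" for w r :: real
    unfolding powr_powr using that by simp
  then show ?case
    using 0 \<alpha> \<beta> by (simp add: energy_form_0 sign_cube_0 power2_eq_square)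
next
  case (Suc d)
  define N where "N r f = (\<Sum>x\<in>sign_cube d. f x powr (2/r))" for r :: real and f :: "(nat \<Rightarrow> int) \<Rightarrow> real"
  define f\<^sub>0 f\<^sub>1 g\<^sub>0 g\<^sub>1 where "f\<^sub>0 x = f (x(d := 1))" and "f\<^sub>1 x = f (x(d := -1))"
    and "g\<^sub>0 x = g (x(d := 1))" and "g\<^sub>1 x = g (x(d := -1))" for x
  note faces = f\<^sub>0_def[abs_def] f\<^sub>1_def[abs_def] g\<^sub>0_def[abs_def] g\<^sub>1_def[abs_def]
  have nn: "0 \<le> f\<^sub>0 x" "0 \<le> f\<^sub>1 x" "0 \<le> g\<^sub>0 x" "0 \<le> g\<^sub>1 x" for x
    using Suc.prems by (simp_all add: faces)
  have N_nonneg: "0 \<le> N r u" for r u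
    unfolding N_def by (intro sum_nonneg) auto
  have IH: "energy_form d u w u w \<le> N \<alpha> u powr \<alpha> * N \<beta> w powr \<beta>"
    if "\<And>x. 0 \<le> u x" "\<And>x. 0 \<le> w x" for u w
    unfolding N_def using Suc.IH that by blast
  have cross: "energy_form d u w u' w' \<le> (N \<alpha> u * N \<alpha> u') powr (\<alpha>/2) * (N \<beta> w * N \<beta> w') powr (\<beta>/2)"
    if "\<And>x. 0 \<le> u x" "\<And>x. 0 \<le> w x" "\<And>x. 0 \<le> u' x" "\<And>x. 0 \<le> w' x" for u w u' w'
  proof (rule power2_le_imp_le)
    have sq: "(z powr (r/2))\<^sup>2 = z powr r" for z r :: real
      by (simp add: power2_eq_square flip: powr_add)
    have "(energy_form d u w u' w')\<^sup>2 \<le> energy_form d u w u w * energy_form d u' w' u' w'"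
      by (rule energy_form_Cauchy_Schwarz)
    also have "\<dots> \<le> (N \<alpha> u powr \<alpha> * N \<beta> w powr \<beta>) * (N \<alpha> u' powr \<alpha> * N \<beta> w' powr \<beta>)"
      by (intro mult_mono IH energy_form_nonneg mult_nonneg_nonneg that) auto
    also have "\<dots> = ((N \<alpha> u * N \<alpha> u') powr (\<alpha>/2) * (N \<beta> w * N \<beta> w') powr (\<beta>/2))\<^sup>2"
      by (simp add: power_mult_distrib sq powr_mult N_nonneg)
    finally show "(energy_form d u w u' w')\<^sup>2 \<le> \<dots>" .
  qed auto
  have "energy_form (Suc d) f g f g =
      energy_form d f\<^sub>0 g\<^sub>0 f\<^sub>0 g\<^sub>0 + energy_form d f\<^sub>0 g\<^sub>1 f\<^sub>0 g\<^sub>1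
    + energy_form d f\<^sub>1 g\<^sub>0 f\<^sub>1 g\<^sub>0 + energy_form d f\<^sub>1 g\<^sub>1 f\<^sub>1 g\<^sub>1
    + (energy_form d f\<^sub>0 g\<^sub>0 f\<^sub>1 g\<^sub>1 + energy_form d f\<^sub>1 g\<^sub>1 f\<^sub>0 g\<^sub>0)"
    unfolding energy_form_Suc faces ..
  also have "\<dots> \<le> (N \<alpha> f\<^sub>0 powr \<alpha> + N \<alpha> f\<^sub>1 powr \<alpha>) * (N \<beta> g\<^sub>0 powr \<beta> + N \<beta> g\<^sub>1 powr \<beta>)
        + 2 * ((N \<alpha> f\<^sub>0 * N \<alpha> f\<^sub>1) powr (\<alpha>/2) * (N \<beta> g\<^sub>0 * N \<beta> g\<^sub>1) powr (\<beta>/2))"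
    using IH[of f\<^sub>0 g\<^sub>0] IH[of f\<^sub>0 g\<^sub>1] IH[of f\<^sub>1 g\<^sub>0] IH[of f\<^sub>1 g\<^sub>1]
      cross[of f\<^sub>0 g\<^sub>0 f\<^sub>1 g\<^sub>1] cross[of f\<^sub>1 g\<^sub>1 f\<^sub>0 g\<^sub>0] nn
    by (simp add: distrib_left distrib_right mult.commute[of "N \<alpha> f\<^sub>1"] mult.commute[of "N \<beta> g\<^sub>1"])
  also have "\<dots> \<le> (N \<alpha> f\<^sub>0 + N \<alpha> f\<^sub>1) powr \<alpha> * (N \<beta> g\<^sub>0 + N \<beta> g\<^sub>1) powr \<beta>"
    by (intro two_point N_nonneg)
  also have "\<dots> = (\<Sum>x\<in>sign_cube (Suc d). f x powr (2/\<alpha>)) powr \<alpha> *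
      (\<Sum>x\<in>sign_cube (Suc d). g x powr (2/\<beta>)) powr \<beta>"
    unfolding sum_sign_cube_Suc by (simp add: N_def faces sum.distrib)
  finally show ?case .
qed

corollary additive_energy_le_powr:
  fixes \<alpha> \<beta> :: real
  assumes \<alpha>: "0 < \<alpha>" and \<beta>: "0 < \<beta>"
    and two_point: "\<And>a\<^sub>0 a\<^sub>1 b\<^sub>0 b\<^sub>1 :: real. 0 \<le> a\<^sub>0 \<Longrightarrow> 0 \<le> a\<^sub>1 \<Longrightarrow> 0 \<le> b\<^sub>0 \<Longrightarrow> 0 \<le> b\<^sub>1 \<Longrightarrow>
      (a\<^sub>0 powr \<alpha> + a\<^sub>1 powr \<alpha>) * (b\<^sub>0 powr \<beta> + b\<^sub>1 powr \<beta>)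
        + 2 * ((a\<^sub>0 * a\<^sub>1) powr (\<alpha>/2) * (b\<^sub>0 * b\<^sub>1) powr (\<beta>/2))
      \<le> (a\<^sub>0 + a\<^sub>1) powr \<alpha> * (b\<^sub>0 + b\<^sub>1) powr \<beta>"
    and A: "A \<subseteq> sign_cube d" and B: "B \<subseteq> sign_cube d"
  shows "real (additive_energy d A B) \<le> real (card A) powr \<alpha> * real (card B) powr \<beta>"
proof -
  have sum_ind: "(\<Sum>x\<in>sign_cube d. (indicator S x :: real) powr r) = card S"
    if "S \<subseteq> sign_cube d" for S and r :: real
  proof -
    have "(\<Sum>x\<in>sign_cube d. (indicator S x :: real) powr r) = (\<Sum>x\<in>sign_cube d. indicator S x)"
      by (intro sum.cong) (auto simp: indicator_def)
    then show ?thesis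
      using that by (simp add: indicator_def of_bool_def sum.If_cases Int_absorb1)
  qed
  have "energy_form d (indicator A) (indicator B) (indicator A) (indicator B)
      \<le> (\<Sum>x\<in>sign_cube d. (indicator A x :: real) powr (2/\<alpha>)) powr \<alpha>
        * (\<Sum>x\<in>sign_cube d. (indicator B x :: real) powr (2/\<beta>)) powr \<beta>"
    by (rule energy_form_le_powr[OF \<alpha> \<beta> two_point]) auto
  then show ?thesis
    unfolding additive_energy_eq_form[OF A B] sum_ind[OF A] sum_ind[OF B] .
qed

section \<open>The bound in the whole range of exponents\<close>

lemma powr_mult_powr_mono_exponent:
  fixes a b s t L :: real
  assumes "0 < b" "b \<le> a" "s \<le> t"
  shows "a powr s * b powr (L - s) \<le> a powr t * b powr (L - t)"
proof -
  have "a powr s * b powr (L - s) = a powr s * b powr (L - t) * b powr (t - s)"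
    by (simp add: mult.assoc flip: powr_add)
  also have "\<dots> \<le> a powr s * b powr (L - t) * a powr (t - s)"
    using assms by (intro mult_left_mono powr_mono2) auto
  also have "\<dots> = a powr t * b powr (L - t)"
    by (simp add: mult.assoc mult.commute[of "b powr _"] flip: powr_add)
  finally show ?thesis .
qed

lemma additive_energy_le_powr_if_exponents_ge:
  assumes s: "\<beta>\<^sub>0 \<le> s" and t: "\<beta>\<^sub>0 \<le> t" and st: "s + t = log 2 6"
    and A: "A \<subseteq> sign_cube d" and B: "B \<subseteq> sign_cube d"
  shows "real (additive_energy d A B) \<le> real (card A) powr s * real (card B) powr t"
proof -
  have endpoint: "real (additive_energy d A B) \<le> real (card A) powr (3/2) * real (card B) powr \<beta>\<^sub>0"
    if "A \<subseteq> sign_cube d" "B \<subseteq> sign_cube d" for A B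
    using \<beta>\<^sub>0_bounds two_point that by (intro additive_energy_le_powr) auto
  have larger: "real (additive_energy d A B) \<le> real (card A) powr s * real (card B) powr t"
    if s: "\<beta>\<^sub>0 \<le> s" and t: "\<beta>\<^sub>0 \<le> t" and st: "s + t = log 2 6" and le: "card B \<le> card A"
      and A: "A \<subseteq> sign_cube d" and B: "B \<subseteq> sign_cube d" for A B s t
  proof (cases "card B = 0")
    case True
    then have "B = {}"
      using finite_subset[OF B] by simp
    then show ?thesis
      by (simp add: additive_energy_def case_prod_unfold)
  next
    case False
    have "real (additive_energy d A B) \<le> real (card A) powr \<beta>\<^sub>0 * real (card B) powr (log 2 6 - \<beta>\<^sub>0)"
      using endpoint[OF B A] by (simp add: additive_energy_commute[of d A] log_2_6 mult.commute)
    also have "\<dots> \<le> real (card A) powr s * real (card B) powr (log 2 6 - s)"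
      using False le s by (intro powr_mult_powr_mono_exponent) auto
    also have "log 2 6 - s = t"
      using st by simp
    finally show ?thesis .
  qed
  show ?thesis
  proof (cases "card B \<le> card A")
    case True
    then show ?thesis
      using larger[OF s t st] A B by simp
  next
    case False
    then show ?thesis
      using larger[OF t s, of A B] A B st by (simp add: additive_energy_commute[of d A] add.commute mult.commute)
  qed
qed

section \<open>Sharpness of the range\<close>

text \<open>
  Equality holds at \<open>s = 0\<close>, where the left-hand side has a critical point. Its second derivative
  there is \<open>\<alpha> * (2 * \<alpha> - 3)\<close>.
\<close>

lemma exponent_le_three_halves:
  fixes \<alpha> :: real
  assumes \<alpha>: "0 < \<alpha>"
    and le: "\<And>s. 0 < s \<Longrightarrow> s < 1 \<Longrightarrow> (1 + s) powr \<alpha> + (1 - s) powr \<alpha> + (1 - s\<^sup>2) powr (\<alpha>/2) \<le> 3"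
  shows "\<alpha> \<le> 3/2"
proof (rule ccontr)
  assume "\<not> \<alpha> \<le> 3/2"
  define \<phi> where "\<phi> s = (1 + s) powr \<alpha> + (1 - s) powr \<alpha> + (1 - s\<^sup>2) powr (\<alpha>/2)" for s
  define \<phi>' where "\<phi>' s = \<alpha> * ((1 + s) powr (\<alpha> - 1) - (1 - s) powr (\<alpha> - 1) - s * (1 - s\<^sup>2) powr (\<alpha>/2 - 1))"
    for s
  have deriv: "(\<phi> has_real_derivative \<phi>' s) (at s)" if "\<bar>s\<bar> < 1" for s
  proof -
    have "s\<^sup>2 < 1"
      using that by (simp add: abs_square_less_1)
    then show ?thesis
      unfolding \<phi>_def \<phi>'_def using that
      by (auto intro!: derivative_eq_intros simp: algebra_simps)
  qed
  have "(\<phi>' has_real_derivative \<alpha> * (2 * \<alpha> - 3)) (at 0)"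
    unfolding \<phi>'_def by (auto intro!: derivative_eq_intros simp: algebra_simps)
  moreover have "0 < \<alpha> * (2 * \<alpha> - 3)"
    using \<alpha> \<open>\<not> \<alpha> \<le> 3/2\<close> by simp
  ultimately obtain e where e: "0 < e" "\<And>h. 0 < h \<Longrightarrow> h < e \<Longrightarrow> \<phi>' 0 < \<phi>' (0 + h)"
    using DERIV_pos_inc_right by blast
  define s where "s = min (e / 2) (1 / 2)"
  have s: "0 < s" "s < 1" "s < e"
    using e(1) by (auto simp: s_def min_def)
  have "\<exists>z. 0 < z \<and> z < s \<and> \<phi> s - \<phi> 0 = (s - 0) * \<phi>' z"
    using s by (intro MVT2 deriv) auto
  then obtain z where z: "0 < z" "z < s" "\<phi> s - \<phi> 0 = (s - 0) * \<phi>' z"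
    by blast
  have "0 < \<phi>' z"
    using e(2)[of z] z s by (simp add: \<phi>'_def)
  then have "\<phi> 0 < \<phi> s"
    using z s by (metis diff_gt_0_iff_gt diff_zero mult_pos_pos)
  moreover have "\<phi> 0 = 3"
    by (simp add: \<phi>_def)
  ultimately show False
    using le[OF s(1,2)] by (simp add: \<phi>_def)
qed

text \<open>
  The \<open>n\<close>-th tensor power of the function on \<open>{-1, 1}\<close> with values \<open>v\<close> at \<open>1\<close> and \<open>1\<close> at \<open>-1\<close>.
\<close>

definition tensor_weight :: "real \<Rightarrow> nat \<Rightarrow> (nat \<Rightarrow> int) \<Rightarrow> real" where
  "tensor_weight v n x = (\<Prod>i<n. if x i = 1 then v else 1)"

lemma tensor_weight_faces:
  "tensor_weight v (Suc n) (x(n := 1)) = v * tensor_weight v n x"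
  "tensor_weight v (Suc n) (x(n := -1)) = tensor_weight v n x"
  by (auto simp: tensor_weight_def intro!: prod.cong)

lemma tensor_weight_eq_power: "tensor_weight v n x = v ^ card {i. i < n \<and> x i = 1}"
  by (simp add: tensor_weight_def prod.If_cases lessThan_def Int_def)

lemma sum_tensor_weight_powr:
  assumes "0 < v"
  shows "(\<Sum>x\<in>sign_cube n. tensor_weight v n x powr r) = (1 + v powr r) ^ n"
proof (induction n)
  case 0
  then show ?case
    by (simp add: sign_cube_0 tensor_weight_def)
next
  case (Suc n)
  have "0 \<le> tensor_weight v n x" for x
    unfolding tensor_weight_eq_power using assms by simp
  then have "(\<Sum>x\<in>sign_cube (Suc n). tensor_weight v (Suc n) x powr r)
      = (1 + v powr r) * (\<Sum>x\<in>sign_cube n. tensor_weight v n x powr r)"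
    unfolding sum_sign_cube_Suc tensor_weight_faces using assms
    by (simp add: powr_mult sum_distrib_left algebra_simps)
  then show ?case
    using Suc.IH by simp
qed

lemma energy_form_tensor_weight:
  "energy_form n (tensor_weight v n) (\<lambda>_. 1) (tensor_weight v n) (\<lambda>_. 1) = (2 * v\<^sup>2 + 2 * v + 2) ^ n"
proof (induction n)
  case 0
  then show ?case
    by (simp add: energy_form_0 tensor_weight_def)
next
  case (Suc n)
  let ?w = "tensor_weight v n"
  have scale: "energy_form n (\<lambda>x. s * ?w x) (\<lambda>_. 1) (\<lambda>x. t * ?w x) (\<lambda>_. 1)
      = s * t * energy_form n ?w (\<lambda>_. 1) ?w (\<lambda>_. 1)" for s t
    by (simp add: energy_form_def sum_distrib_left mult_ac)
  show ?case
    unfolding energy_form_Suc tensor_weight_faces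
    using Suc.IH scale[of v v] scale[of v 1] scale[of 1 v]
    by (simp add: algebra_simps power2_eq_square)
qed

text \<open>
  The energy of a combination is at most the number of its terms times the sum of the energies of
  the terms, because the form is positive semidefinite in its first and third arguments.
\<close>

lemma energy_form_sum_le:
  fixes c :: "'i \<Rightarrow> real"
  assumes F: "\<And>i x. 0 \<le> F i x" and g: "\<And>x. 0 \<le> g x"
  shows "energy_form d (\<lambda>x. \<Sum>i\<in>I. c i * F i x) g (\<lambda>x. \<Sum>i\<in>I. c i * F i x) g
    \<le> card I * (\<Sum>i\<in>I. (c i)\<^sup>2 * energy_form d (F i) g (F i) g)"
proof -
  define E where "E i j = energy_form d (F i) g (F j) g" for i j
  have left: "energy_form d (\<lambda>x. \<Sum>i\<in>I. c i * F i x) g h g = (\<Sum>i\<in>I. c i * energy_form d (F i) g h g)" for h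
    unfolding energy_form_def sum_distrib_left sum_distrib_right
    by (simp only: sum.swap[of _ I] mult_ac)
  have right: "energy_form d h g (\<lambda>x. \<Sum>i\<in>I. c i * F i x) g = (\<Sum>i\<in>I. c i * energy_form d h g (F i) g)" for h
    unfolding energy_form_def sum_distrib_left sum_distrib_right
    by (simp only: sum.swap[of _ I] mult_ac)
  have self: "0 \<le> E i i" for i
    unfolding E_def by (intro energy_form_nonneg F g)
  have "energy_form d (\<lambda>x. \<Sum>i\<in>I. c i * F i x) g (\<lambda>x. \<Sum>i\<in>I. c i * F i x) g
      = (\<Sum>i\<in>I. \<Sum>j\<in>I. c i * c j * E i j)"
    unfolding left right E_def by (simp add: sum_distrib_left mult_ac)
  also have "\<dots> \<le> (\<Sum>i\<in>I. \<Sum>j\<in>I. ((c i)\<^sup>2 * E i i + (c j)\<^sup>2 * E j j) / 2)"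
  proof (intro sum_mono)
    fix i j
    define u w where "u = (c i)\<^sup>2 * E i i" and "w = (c j)\<^sup>2 * E j j"
    have "(c i * c j * E i j)\<^sup>2 = (c i * c j)\<^sup>2 * (E i j)\<^sup>2"
      by (simp add: power_mult_distrib)
    also have "\<dots> \<le> (c i * c j)\<^sup>2 * (E i i * E j j)"
      unfolding E_def by (intro mult_left_mono energy_form_Cauchy_Schwarz) simp
    also have "\<dots> = u * w"
      by (simp add: u_def w_def power_mult_distrib)
    also have "\<dots> \<le> ((u + w) / 2)\<^sup>2"
      using zero_le_power2[of "u - w"] by (simp add: power2_eq_square field_simps)
    finally show "c i * c j * E i j \<le> ((c i)\<^sup>2 * E i i + (c j)\<^sup>2 * E j j) / 2"
      unfolding u_def w_def by (rule power2_le_imp_le) (simp add: self)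
  qed
  also have "\<dots> = card I * (\<Sum>i\<in>I. (c i)\<^sup>2 * E i i)"
    by (simp add: add_divide_distrib sum.distrib flip: sum_divide_distrib sum_distrib_left)
  finally show ?thesis
    unfolding E_def .
qed

text \<open>Polynomial factors are removed by passing to high powers.\<close>

lemma le_of_power_le_square_mult_power:
  fixes X Y :: real
  assumes Y: "0 < Y" and le: "\<And>n. 1 \<le> n \<Longrightarrow> X ^ n \<le> (real n + 1)\<^sup>2 * Y ^ n"
  shows "X \<le> Y"
proof (rule ccontr)
  assume "\<not> X \<le> Y"
  define r where "r = X / Y - 1"
  have r: "0 < r" "X = (1 + r) * Y"
    using Y \<open>\<not> X \<le> Y\<close> by (simp_all add: r_def field_simps)
  \<comment> \<open>Bernoulli's inequality bounds \<open>(1 + r) ^ (3 * m)\<close> below by \<open>(m * r) ^ 3\<close>, which exceeds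
    \<open>(4 * m)\<^sup>2 \<ge> (3 * m + 1)\<^sup>2\<close> as soon as \<open>m > 16 / r ^ 3\<close>.\<close>
  obtain m where m: "16 / r ^ 3 < real m"
    using reals_Archimedean2 by blast
  have "0 < 16 / r ^ 3"
    using r by simp
  then have m1: "1 \<le> m"
    using m by linarith
  have "(1 + r) ^ (3 * m) * Y ^ (3 * m) \<le> (real (3 * m) + 1)\<^sup>2 * Y ^ (3 * m)"
    using le[of "3 * m"] m1 by (simp add: r(2) power_mult_distrib)
  then have "(1 + r) ^ (3 * m) \<le> (real (3 * m) + 1)\<^sup>2"
    using Y by simp
  also have "\<dots> \<le> (4 * real m)\<^sup>2"
    using m1 by (intro power_mono) auto
  finally have upper: "(1 + r) ^ (3 * m) \<le> 16 * (real m)\<^sup>2"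
    by (simp add: power_mult_distrib)
  have "real m * r \<le> (1 + r) ^ m"
    using Bernoulli_inequality[of r m] r by simp
  then have "(real m * r) ^ 3 \<le> ((1 + r) ^ m) ^ 3"
    using r by (intro power_mono) auto
  also have "((1 + r) ^ m) ^ 3 = (1 + r) ^ (3 * m)"
    by (simp add: mult.commute flip: power_mult)
  also note upper
  finally have "(real m)\<^sup>2 * (real m * r ^ 3) \<le> (real m)\<^sup>2 * 16"
    by (simp add: power_mult_distrib power2_eq_square power3_eq_cube mult_ac)
  then have "real m * r ^ 3 \<le> 16"
    using m1 by simp
  then show False
    using m r by (simp add: field_simps)
qed

text \<open>The full cube as second set already forces the upper bound on the exponent of the first.\<close>

lemma exponent_le_of_additive_energy_le:
  fixes \<alpha> \<beta> :: real
  assumes \<alpha>: "0 < \<alpha>" and sum: "\<alpha> + \<beta> = log 2 6"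
    and le: "\<And>d A. 1 \<le> d \<Longrightarrow> A \<subseteq> sign_cube d \<Longrightarrow>
      real (additive_energy d A (sign_cube d)) \<le> real (card A) powr \<alpha> * real (card (sign_cube d)) powr \<beta>"
  shows "\<alpha> \<le> 3/2"
proof -
  have limit: "2 * v\<^sup>2 + 2 * v + 2 \<le> (1 + v powr (2/\<alpha>)) powr \<alpha> * 2 powr \<beta>" if v: "0 < v" for v :: real
  proof (rule le_of_power_le_square_mult_power)
    have pos: "0 < 1 + v powr (2/\<alpha>)"
      by (simp add: add_pos_nonneg)
    then show "0 < (1 + v powr (2/\<alpha>)) powr \<alpha> * 2 powr \<beta>"
      by simp
    fix n :: nat assume n: "1 \<le> n"
    define L where "L k = {x \<in> sign_cube n. card {i. i < n \<and> x i = 1} = k}" for k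
    define M where "M = ((1 + v powr (2/\<alpha>)) powr \<alpha> * 2 powr \<beta>) ^ n"
    have L: "L k \<subseteq> sign_cube n" for k
      by (auto simp: L_def)
    have card_cube: "card (sign_cube n) = 2 ^ n"
      by (simp add: sign_cube_def card_PiE numeral_2_eq_2)
    have level: "(v ^ k)\<^sup>2 * energy_form n (indicator (L k)) (\<lambda>_. 1) (indicator (L k)) (\<lambda>_. 1) \<le> M" for k
    proof -
      have sq: "(v ^ k)\<^sup>2 = ((v ^ k) powr (2/\<alpha>)) powr \<alpha>"
        unfolding powr_powr using \<alpha> v by simp
      have "energy_form n (indicator (L k)) (\<lambda>_. 1) (indicator (L k)) (\<lambda>_. 1)
          = energy_form n (indicator (L k)) (indicator (sign_cube n)) (indicator (L k)) (indicator (sign_cube n))"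
        unfolding energy_form_def by (intro sum.cong refl) simp
      also have "\<dots> = real (additive_energy n (L k) (sign_cube n))"
        by (simp add: additive_energy_eq_form L)
      also have "\<dots> \<le> card (L k) powr \<alpha> * (2 ^ n) powr \<beta>"
        using le[OF n L, of k] by (simp add: card_cube)
      finally have "(v ^ k)\<^sup>2 * energy_form n (indicator (L k)) (\<lambda>_. 1) (indicator (L k)) (\<lambda>_. 1)
          \<le> (v ^ k)\<^sup>2 * (card (L k) powr \<alpha> * (2 ^ n) powr \<beta>)"
        by (intro mult_left_mono) auto
      also have "(v ^ k)\<^sup>2 * (card (L k) powr \<alpha> * (2 ^ n) powr \<beta>)
          = (\<Sum>x\<in>L k. tensor_weight v n x powr (2/\<alpha>)) powr \<alpha> * (2 ^ n) powr \<beta>"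
        unfolding sq by (simp add: L_def tensor_weight_eq_power powr_mult mult_ac)
      also have "\<dots> \<le> (\<Sum>x\<in>sign_cube n. tensor_weight v n x powr (2/\<alpha>)) powr \<alpha> * (2 ^ n) powr \<beta>"
        using L \<alpha> by (intro mult_right_mono powr_mono2 sum_mono2 sum_nonneg) auto
      also have "\<dots> = M"
        unfolding sum_tensor_weight_powr[OF v] M_def power_mult_distrib using pos
        by (simp add: powr_powr mult.commute flip: powr_realpow)
      finally show ?thesis .
    qed
    have "(2 * v\<^sup>2 + 2 * v + 2) ^ n
        = energy_form n (tensor_weight v n) (\<lambda>_. 1) (tensor_weight v n) (\<lambda>_. 1)"
      by (simp add: energy_form_tensor_weight)
    also have "\<dots> = energy_form n (\<lambda>x. \<Sum>k\<le>n. v ^ k * indicator (L k) x) (\<lambda>_. 1)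
        (\<lambda>x. \<Sum>k\<le>n. v ^ k * indicator (L k) x) (\<lambda>_. 1)"
    proof -
      have "tensor_weight v n x = (\<Sum>k\<le>n. v ^ k * indicator (L k) x)" if "x \<in> sign_cube n" for x
      proof -
        have "card {i. i < n \<and> x i = 1} \<le> n"
          using card_mono[of "{..<n}" "{i. i < n \<and> x i = 1}"] by auto
        then show ?thesis
          using that by (simp add: L_def indicator_def of_bool_def if_distrib sum.delta tensor_weight_eq_power cong: if_cong)
      qed
      then show ?thesis
        unfolding energy_form_def by (intro sum.cong refl) simp
    qed
    also have "\<dots> \<le> card {..n} *
        (\<Sum>k\<le>n. (v ^ k)\<^sup>2 * energy_form n (indicator (L k)) (\<lambda>_. 1) (indicator (L k)) (\<lambda>_. 1))"
      by (intro energy_form_sum_le) auto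
    also have "\<dots> \<le> card {..n} * (\<Sum>k\<le>n. M)"
      by (intro mult_left_mono sum_mono level) auto
    also have "\<dots> = (real n + 1)\<^sup>2 * M"
      by (simp add: power2_eq_square algebra_simps)
    finally show "(2 * v\<^sup>2 + 2 * v + 2) ^ n
        \<le> (real n + 1)\<^sup>2 * ((1 + v powr (2/\<alpha>)) powr \<alpha> * 2 powr \<beta>) ^ n"
      unfolding M_def .
  qed
  show ?thesis
  proof (rule exponent_le_three_halves[OF \<alpha>])
    fix s :: real assume s: "0 < s" "s < 1"
    \<comment> \<open>The substitution \<open>v = q powr (\<alpha>/2)\<close>, followed by multiplication with \<open>(1 - s) powr \<alpha>\<close>,
      makes the right-hand side constant.\<close>
    define q where "q = (1 + s) / (1 - s)"
    have q: "0 < q"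
      using s by (simp add: q_def)
    have qs: "(1 - s) * q = 1 + s"
      using s by (simp add: q_def)
    have "(1 - s) powr \<alpha> * (2 * (q powr (\<alpha>/2))\<^sup>2 + 2 * q powr (\<alpha>/2) + 2)
        \<le> (1 - s) powr \<alpha> * ((1 + (q powr (\<alpha>/2)) powr (2/\<alpha>)) powr \<alpha> * 2 powr \<beta>)"
      using limit[of "q powr (\<alpha>/2)"] q by (intro mult_left_mono) auto
    also have "(q powr (\<alpha>/2)) powr (2/\<alpha>) = q"
      unfolding powr_powr using \<alpha> q by simp
    also have "(1 - s) powr \<alpha> * ((1 + q) powr \<alpha> * 2 powr \<beta>) = ((1 - s) + (1 - s) * q) powr \<alpha> * 2 powr \<beta>"
      using s q by (simp add: distrib_left flip: powr_mult mult.assoc)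
    also have "\<dots> = 2 powr \<alpha> * 2 powr \<beta>"
      unfolding qs by simp
    also have "\<dots> = 6"
      by (simp add: sum flip: powr_add)
    finally have "(1 - s) powr \<alpha> * (2 * (q powr (\<alpha>/2))\<^sup>2 + 2 * q powr (\<alpha>/2) + 2) \<le> 6" .
    moreover have "(1 - s) powr \<alpha> * (q powr (\<alpha>/2))\<^sup>2 = (1 + s) powr \<alpha>"
      using s q by (simp add: power2_eq_square qs flip: powr_add powr_mult)
    moreover have "(1 - s) powr \<alpha> * q powr (\<alpha>/2) = (1 - s\<^sup>2) powr (\<alpha>/2)"
    proof -
      have "(1 - s) powr \<alpha> * q powr (\<alpha>/2) = (1 - s) powr (\<alpha>/2) * ((1 - s) powr (\<alpha>/2) * q powr (\<alpha>/2))"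
        by (simp flip: powr_add mult.assoc)
      also have "\<dots> = ((1 - s) * ((1 - s) * q)) powr (\<alpha>/2)"
        using s q by (simp add: powr_mult)
      also have "(1 - s) * ((1 - s) * q) = 1 - s\<^sup>2"
        unfolding qs by (simp add: power2_eq_square algebra_simps)
      finally show ?thesis .
    qed
    ultimately show "(1 + s) powr \<alpha> + (1 - s) powr \<alpha> + (1 - s\<^sup>2) powr (\<alpha>/2) \<le> 3"
      by (simp add: algebra_simps)
  qed
qed

section \<open>The range of exponents\<close>

theorem corollary1p7:
  "(\<forall>p q :: real.
      4/3 \<le> p \<and> p \<le> 1 / (log 2 3 / 2 - 1/4) \<and>
      4/3 \<le> q \<and> q \<le> 1 / (log 2 3 / 2 - 1/4) \<and>
      1/p + 1/q = log 2 6 / 2 \<longrightarrow>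
      (\<forall>d\<ge>1. \<forall>A B. A \<subseteq> sign_cube d \<and> B \<subseteq> sign_cube d \<longrightarrow>
         real (additive_energy d A B) \<le> real (card A) powr (2/p) * real (card B) powr (2/q)))
   \<and>
   (\<forall>p q :: ereal.
      1 \<le> p \<and> p \<le> \<infinity> \<and> 1 \<le> q \<and> q \<le> \<infinity> \<and>
      1/p + 1/q = ereal (log 2 6 / 2) \<and>
      (\<forall>d\<ge>1. \<forall>A B. A \<subseteq> sign_cube d \<and> B \<subseteq> sign_cube d \<longrightarrow>
         real (additive_energy d A B)
           \<le> real (card A) powr real_of_ereal (2/p) * real (card B) powr real_of_ereal (2/q)) \<longrightarrow>
      ereal (4/3) \<le> p \<and> p \<le> ereal (1 / (log 2 3 / 2 - 1/4)) \<and>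
      ereal (4/3) \<le> q \<and> q \<le> ereal (1 / (log 2 3 / 2 - 1/4)))"
  (is "?sufficient \<and> ?necessary")
proof
  have half: "log 2 3 / 2 - 1/4 = \<beta>\<^sub>0 / 2"
    by (simp add: \<beta>\<^sub>0_def)
  have \<beta>\<^sub>0_pos: "0 < \<beta>\<^sub>0"
    using \<beta>\<^sub>0_bounds by simp
  have le_iff: "p \<le> 1 / (log 2 3 / 2 - 1/4) \<longleftrightarrow> \<beta>\<^sub>0 \<le> 2 / p" if "0 < p" for p :: real
    unfolding half using \<beta>\<^sub>0_pos that by (simp add: field_simps)
  show ?sufficient
  proof (intro allI impI; elim conjE)
    fix p q :: real and d A B
    assume p: "4/3 \<le> p" "p \<le> 1 / (log 2 3 / 2 - 1/4)" and q: "4/3 \<le> q" "q \<le> 1 / (log 2 3 / 2 - 1/4)"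
      and pq: "1/p + 1/q = log 2 6 / 2" and AB: "A \<subseteq> sign_cube d" "B \<subseteq> sign_cube d"
    show "real (additive_energy d A B) \<le> real (card A) powr (2/p) * real (card B) powr (2/q)"
    proof (rule additive_energy_le_powr_if_exponents_ge[OF _ _ _ AB])
      show "\<beta>\<^sub>0 \<le> 2/p" "\<beta>\<^sub>0 \<le> 2/q"
        using p q le_iff[of p] le_iff[of q] by auto
      show "2/p + 2/q = log 2 6"
        using pq by simp
    qed
  qed
  show ?necessary
  proof (intro allI impI; elim conjE)
    fix p q :: ereal
    assume p1: "1 \<le> p" and q1: "1 \<le> q" and pq: "1/p + 1/q = ereal (log 2 6 / 2)"
      and le: "\<forall>d\<ge>1. \<forall>A B. A \<subseteq> sign_cube d \<and> B \<subseteq> sign_cube d \<longrightarrow>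
         real (additive_energy d A B)
           \<le> real (card A) powr real_of_ereal (2/p) * real (card B) powr real_of_ereal (2/q)"
    \<comment> \<open>An infinite exponent would force the other one below \<open>1\<close>, because \<open>log 2 6 > 2\<close>.\<close>
    have not_inf: "x \<noteq> \<infinity>" if "1 \<le> y" "1/x + 1/y = ereal (log 2 6 / 2)" for x y :: ereal
    proof
      assume "x = \<infinity>"
      with that have y: "1/y = ereal (log 2 6 / 2)"
        by simp
      then obtain r where r: "y = ereal r" "1 \<le> r"
        using \<open>1 \<le> y\<close> \<beta>\<^sub>0_bounds log_2_6 by (cases y) (auto simp: one_ereal_def)
      then have "1 / r = log 2 6 / 2"
        using y by (simp add: one_ereal_def)
      moreover have "1 / r \<le> 1"
        using r by simp
      ultimately show False
        using \<beta>\<^sub>0_bounds log_2_6 by linarith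
    qed
    have "p \<noteq> \<infinity>" "q \<noteq> \<infinity>"
      using not_inf[OF q1 pq] not_inf[of p q] p1 pq by (auto simp: add.commute)
    then obtain r s where r: "p = ereal r" "1 \<le> r" and s: "q = ereal s" "1 \<le> s"
      using p1 q1 by (cases p; cases q) (auto simp: one_ereal_def)
    have rs: "1/r + 1/s = log 2 6 / 2"
      using pq r s by (simp add: one_ereal_def)
    have two: "real_of_ereal (2 / ereal x) = 2 / x" if "1 \<le> x" for x
      using that by (simp add: numeral_eq_ereal)
    have bound: "real (additive_energy d A B) \<le> real (card A) powr (2/r) * real (card B) powr (2/s)"
      if "1 \<le> d" "A \<subseteq> sign_cube d" "B \<subseteq> sign_cube d" for d A B
      using le that r s two by simp
    have r32: "2/r \<le> 3/2"
      using r s rs bound by (intro exponent_le_of_additive_energy_le[of _ "2/s"]) auto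
    have s32: "2/s \<le> 3/2"
    proof (rule exponent_le_of_additive_energy_le[of _ "2/r"])
      show "real (additive_energy d A (sign_cube d)) \<le> real (card A) powr (2/s) * real (card (sign_cube d)) powr (2/r)"
        if "1 \<le> d" "A \<subseteq> sign_cube d" for d A
        using bound[of d "sign_cube d" A] that by (simp add: additive_energy_commute[of d A] mult.commute)
    qed (use s rs in auto)
    have "\<beta>\<^sub>0 \<le> 2/r" "\<beta>\<^sub>0 \<le> 2/s"
      using r32 s32 rs log_2_6 by auto
    then show "ereal (4/3) \<le> p \<and> p \<le> ereal (1 / (log 2 3 / 2 - 1/4)) \<and>
        ereal (4/3) \<le> q \<and> q \<le> ereal (1 / (log 2 3 / 2 - 1/4))"
      using r s r32 s32 le_iff[of r] le_iff[of s] by (simp add: field_simps)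
  qed
qed

end
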